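(* Let $p \in [1,\infty)$, $0 \leq s < \infty$, and $t \in [0,1]$. Let $f,g,h \colon \mathbb{R}^n \to \mathbb{R}_+$ be a triple of bounded integrable functions. Suppose, in addition, that this triple satisfies the condition $$h\left((1-t)^{\frac{1}{p}}(1-\lambda)^{\frac{p-1}{p}}x + t^{\frac{1}{p}}\lambda^{\frac{p-1}{p}}y\right) \geq \left[(1-t)^{\frac{1}{p}}(1-\lambda)^{\frac{p-1}{p}} f(x)^{\frac{1}{s}} + t^{\frac{1}{p}}\lambda^{\frac{p-1}{p}}g(y)^{\frac{1}{s}}\right]^s$$ for every $x \in \mathrm{supp}(f)$, $y\in \mathrm{supp}(g)$ and every $\lambda \in [0,1]$. Then $$\int_{\mathbb{R}^n}h(x)\,dx \geq M_{\frac{p}{n+s}}^t\left(\int_{\mathbb{R}^n}f(x)\,dx,\int_{\mathbb{R}^n}g(x)\,dx \right).$$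
   Context: $\mathbb{R}_+=[0,\infty)$; $\mathrm{supp}(f)=\{x\colon f(x)>0\}$. For $\alpha>0$, $t\in[0,1]$ and $a,b\ge0$: $M_\alpha^t(a,b)=((1-t)a^\alpha+tb^\alpha)^{1/\alpha}$ if $ab>0$, and $M_\alpha^t(a,b)=0$ if $ab=0$. When $s=0$ the right-hand side of the condition is understood as its limit as $s\to0^+$. When $p=1$ the convention $0^0=1$ is used for $(1-\lambda)^{\frac{p-1}{p}}$ and $\lambda^{\frac{p-1}{p}}$. *)

theory Defs
  imports "HOL-Analysis.Analysis"
begin

definition supp :: "('a \<Rightarrow> real) \<Rightarrow> 'a set" where
  "supp f = {x. f x > 0}"

definition power_mean :: "real \<Rightarrow> real \<Rightarrow> real \<Rightarrow> real \<Rightarrow> real" where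
  "power_mean \<alpha> t a b =
     (if a * b > 0 then ((1 - t) * a powr \<alpha> + t * b powr \<alpha>) powr (1 / \<alpha>) else 0)"

(* The library has 0 powr 0 = 0; here the convention is 0^0 = 1. *)
definition powr1 :: "real \<Rightarrow> real \<Rightarrow> real" where
  "powr1 x r = (if r = 0 then 1 else x powr r)"

definition coeff_f :: "real \<Rightarrow> real \<Rightarrow> real \<Rightarrow> real" where
  "coeff_f p t l = (1 - t) powr (1 / p) * powr1 (1 - l) ((p - 1) / p)"

definition coeff_g :: "real \<Rightarrow> real \<Rightarrow> real \<Rightarrow> real" where
  "coeff_g p t l = t powr (1 / p) * powr1 l ((p - 1) / p)"

definition bracket_pos :: "real \<Rightarrow> real \<Rightarrow> real \<Rightarrow> real \<Rightarrow> real \<Rightarrow> real \<Rightarrow> real" where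
  "bracket_pos p s t l a b =
     (coeff_f p t l * a powr (1 / s) + coeff_g p t l * b powr (1 / s)) powr s"

(* For s = 0 the bracket is its limit as s tends to 0 from the right. For a, b > 0 this limit
   exists: it is max a b if both coefficients are positive, a (resp. b) if only the first
   (resp. second) coefficient is positive, and 0 if both coefficients vanish. *)
definition bracket :: "real \<Rightarrow> real \<Rightarrow> real \<Rightarrow> real \<Rightarrow> real \<Rightarrow> real \<Rightarrow> real" where
  "bracket p s t l a b =
     (if s = 0 then Lim (at_right 0) (\<lambda>\<sigma>. bracket_pos p \<sigma> t l a b)
      else bracket_pos p s t l a b)"

end

theory Submission
  imports Defs
begin

text \<open>
  Let \<open>0 < t < 1\<close> and let \<open>f\<close> and \<open>g\<close> have positive integrals; the other cases are
  immediate. Fix the parameter \<open>l\<close> strictly between \<open>0\<close> and \<open>1\<close>, and write \<open>c\<close>, \<open>d\<close> for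
  the coefficients of \<open>x\<close> and \<open>y\<close> and \<open>n\<close> for the dimension. The two coefficients need not
  add up to \<open>1\<close>, but they can be absorbed into \<open>F u = c\<^sup>s f (u / c)\<close> and \<open>G v = d\<^sup>s g (v /
  d)\<close>. What remains is an additive form of the Borell-Brascamp-Lieb inequality in which
  neither \<open>p\<close>, \<open>t\<close> nor \<open>l\<close> occurs: if \<open>H (u + v) \<ge> (F(u)\<^bsup>1/s\<^esup> + G(v)\<^bsup>1/s\<^esup>)\<^sup>s\<close> whenever \<open>F
  u\<close> and \<open>G v\<close> are positive (with the maximum of \<open>F u\<close> and \<open>G v\<close> on the right for \<open>s =
  0\<close>), then the integrals satisfy the same relation with \<open>s + n\<close> in place of \<open>s\<close>
  (\<open>integral_ge_psum_lborel\<close>). For the original functions this says \<open>\<integral>h \<ge> (c a + d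
  b)\<^bsup>n+s\<^esup>\<close> with \<open>a = (\<integral>f)\<^bsup>1/(n+s)\<^esup>\<close> and \<open>b = (\<integral>g)\<^bsup>1/(n+s)\<^esup>\<close> (\<open>integral_ge_psum_lebesgue\<close>).
  By the equality case of Hoelder's inequality, \<open>l\<close> can be chosen such that \<open>c a + d b =
  ((1 - t) a\<^sup>p + t b\<^sup>p)\<^bsup>1/p\<^esup>\<close> (\<open>exists_optimal_coeffs\<close>), and the right-hand side becomes
  the power mean of the claim.

  The additive inequality tensorises: integrating over one coordinate preserves its
  hypothesis and raises \<open>s\<close> by \<open>1\<close> (\<open>integral_ge_psum_PiM\<close>).  So everything rests on the
  real line (\<open>integral_ge_psum_real\<close>), where the measure of a sumset is at least the sum of
  the measures.  Applied to the level sets of \<open>F\<close> and \<open>G\<close>, normalised to have supremum \<open>1\<close>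
  so that both level sets are nonempty for the same heights, this gives a linear
  inequality between the integrals, and Hoelder's inequality turns it into the claim.

  The induction needs Borel measurable functions that are bounded with bounded support;
  truncation and modification on null sets provide them.
\<close>

section \<open>The sum with a reciprocal exponent\<close>

text \<open>
  The case \<open>s = 0\<close> is the limit of the other one as \<open>s\<close> decreases to \<open>0\<close>.
  For \<open>s = 1/\<alpha>\<close> this is the \<open>\<alpha>\<close>-sum \<open>(a\<^sup>\<alpha> + b\<^sup>\<alpha>)\<^bsup>1/\<alpha>\<^esup>\<close>; the parameter is the
  reciprocal exponent because that is the quantity to which integration over one
  real variable adds \<open>1\<close>.
\<close>
definition psum :: "real \<Rightarrow> real \<Rightarrow> real \<Rightarrow> real" where
  "psum s a b = (if s = 0 then max a b else (a powr (1 / s) + b powr (1 / s)) powr s)"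

lemma psum_pos: "0 < a \<Longrightarrow> 0 < b \<Longrightarrow> 0 < psum s a b"
  by (auto simp: psum_def add_pos_pos less_imp_neq[THEN not_sym])

lemma psum_strict_mono:
  assumes "0 \<le> s" "0 \<le> a" "a < a'" "0 \<le> b" "b < b'"
  shows "psum s a b < psum s a' b'"
proof (cases "s = 0")
  case False
  then have "0 < s" using assms by simp
  then have "a powr (1 / s) < a' powr (1 / s)" "b powr (1 / s) < b' powr (1 / s)"
    using assms by (auto intro!: powr_less_mono2)
  then show ?thesis
    using \<open>0 < s\<close> by (auto simp: psum_def intro!: powr_less_mono2 add_strict_mono)
qed (use assms in \<open>auto simp: psum_def\<close>)

lemma psum_mono:
  assumes "0 \<le> s" "0 \<le> a" "a \<le> a'" "0 \<le> b" "b \<le> b'"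
  shows "psum s a b \<le> psum s a' b'"
proof (cases "s = 0")
  case False
  then show ?thesis
    using assms by (auto simp: psum_def intro!: powr_mono2 add_mono)
qed (use assms in \<open>auto simp: psum_def\<close>)

lemma psum_mult_left:
  assumes "0 \<le> s" "0 \<le> c" "0 \<le> a" "0 \<le> b"
  shows "psum s (c * a) (c * b) = c * psum s a b"
proof (cases "s = 0")
  case True
  then show ?thesis using assms by (simp add: psum_def max_mult_distrib_left)
next
  case False
  have "psum s (c * a) (c * b) = (c powr (1 / s) * (a powr (1 / s) + b powr (1 / s))) powr s"
    using False assms by (simp add: psum_def powr_mult algebra_simps)
  also have "\<dots> = (c powr (1 / s)) powr s * psum s a b"
    unfolding psum_def using False by (simp only: powr_mult if_False)
  also have "(c powr (1 / s)) powr s = c"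
    using False assms by (simp add: powr_powr)
  finally show ?thesis .
qed

lemma tendsto_psum:
  assumes s: "0 < s" and "(u \<longlongrightarrow> a) F" "(v \<longlongrightarrow> b) F" "0 < a" "0 < b"
  shows "((\<lambda>k. psum s (u k) (v k)) \<longlongrightarrow> psum s a b) F"
proof -
  have "a powr (1/s) + b powr (1/s) \<noteq> 0"
    using assms by (smt (verit) powr_gt_zero)
  then show ?thesis
    using assms unfolding psum_def by (auto intro!: tendsto_intros)
qed

text \<open>
  Hoelder's inequality for two terms, in the form that trades the suprema \<open>a\<close>, \<open>b\<close>
  of two functions against their integrals \<open>x\<close>, \<open>y\<close>.  With \<open>\<xi> = x\<^bsup>1/(s+1)\<^esup>\<close>,
  \<open>\<eta> = y\<^bsup>1/(s+1)\<^esup>\<close> and \<open>w\<close> the share of \<open>a\<^bsup>1/s\<^esup>\<close> in \<open>a\<^bsup>1/s\<^esup> + b\<^bsup>1/s\<^esup>\<close>, it is the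
  convexity of \<open>z \<mapsto> z\<^bsup>s+1\<^esup>\<close> at \<open>\<xi> + \<eta> = w (\<xi>/w) + (1 - w) (\<eta>/(1 - w))\<close>.
\<close>
lemma psum_Hoelder:
  assumes s: "0 \<le> s" and pos: "0 < a" "0 < b" "0 < x" "0 < y"
  shows "psum (s + 1) x y \<le> psum s a b * (x / a + y / b)"
proof (cases "s = 0")
  case True
  have "x \<le> max a b * (x / a)" "y \<le> max a b * (y / b)"
    using pos by (auto simp: field_simps)
  then show ?thesis using True pos by (auto simp: psum_def algebra_simps)
next
  case False
  then have s: "0 < s" using s by simp
  define \<alpha> \<beta> where "\<alpha> = a powr (1 / s)" and "\<beta> = b powr (1 / s)"
  define \<xi> \<eta> where "\<xi> = x powr (1 / (s + 1))" and "\<eta> = y powr (1 / (s + 1))"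
  define w where "w = \<alpha> / (\<alpha> + \<beta>)"
  have p: "0 < \<alpha>" "0 < \<beta>" "0 < \<xi>" "0 < \<eta>"
    using pos by (simp_all add: \<alpha>_def \<beta>_def \<xi>_def \<eta>_def)
  have a: "a = \<alpha> powr s" "b = \<beta> powr s" and x: "x = \<xi> powr (s + 1)" "y = \<eta> powr (s + 1)"
    using pos s by (simp_all add: \<alpha>_def \<beta>_def \<xi>_def \<eta>_def powr_powr)
  have w: "0 < w" "0 < 1 - w" and w1: "1 - w = \<beta> / (\<alpha> + \<beta>)"
    using p by (auto simp: w_def field_simps)
  have summand: "v * (z / v) powr (s + 1) = S powr s * (z powr (s + 1) / c powr s)"
    if "v = c / S" "0 < c" "0 < S" "0 < z" for v c S z :: real
  proof -
    have v: "0 < v" using that by simp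
    have "v * (z / v) powr (s + 1) = z powr (s + 1) / v powr s"
      using v that(4) by (simp add: powr_divide powr_add)
    also have "v powr s = c powr s / S powr s"
      using that by (simp add: powr_divide)
    finally show ?thesis by simp
  qed
  have conv: "convex_on {0<..} (\<lambda>z. z powr (s + 1))"
    using s by (intro powr_convex) simp
  have "(\<xi> + \<eta>) powr (s + 1) = ((1 - w) * (\<eta> / (1 - w)) + w * (\<xi> / w)) powr (s + 1)"
    using w by (simp add: add.commute)
  also have "\<dots> \<le> (1 - w) * (\<eta> / (1 - w)) powr (s + 1) + w * (\<xi> / w) powr (s + 1)"
    using convex_onD[OF conv, of w "\<eta> / (1 - w)" "\<xi> / w"] w p by simp
  also have "\<dots> = (\<alpha> + \<beta>) powr s * (y / b) + (\<alpha> + \<beta>) powr s * (x / a)"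
    using summand[of "1 - w" \<beta> "\<alpha> + \<beta>" \<eta>] summand[of w \<alpha> "\<alpha> + \<beta>" \<xi>] p w1 by (simp add: w_def a x)
  finally have "(\<xi> + \<eta>) powr (s + 1) \<le> (\<alpha> + \<beta>) powr s * (x / a + y / b)"
    by (simp only: distrib_left add.commute)
  moreover have "psum (s + 1) x y = (\<xi> + \<eta>) powr (s + 1)" "psum s a b = (\<alpha> + \<beta>) powr s"
    using s by (simp_all add: psum_def \<alpha>_def \<beta>_def \<xi>_def \<eta>_def)
  ultimately show ?thesis by simp
qed

section \<open>Sumsets and level sets on the real line\<close>

text \<open>
  The Brunn-Minkowski inequality on the line.  Take \<open>a \<in> A\<close> within \<open>e/2\<close> of the supremum
  of \<open>A\<close> and \<open>b \<in> B\<close> within \<open>e/2\<close> of the infimum of \<open>B\<close>.  The translate by \<open>b\<close> of the part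
  of \<open>A\<close> below \<open>a\<close> and the translate by \<open>a\<close> of the part of \<open>B\<close> above \<open>b\<close> both lie in the
  sumset, on opposite sides of \<open>a + b\<close>, and only measure \<open>e\<close> has been discarded.
\<close>
lemma emeasure_sumset_ge:
  fixes A B C :: "real set"
  assumes meas: "A \<in> sets borel" "B \<in> sets borel" "C \<in> sets borel"
    and ne: "A \<noteq> {}" "B \<noteq> {}" and bdd: "bounded A" "bounded B"
    and sub: "\<And>a b. a \<in> A \<Longrightarrow> b \<in> B \<Longrightarrow> a + b \<in> C"
  shows "emeasure lborel A + emeasure lborel B \<le> emeasure lborel C"
proof (rule ennreal_le_epsilon)
  fix e :: real assume e: "0 < e"
  note [measurable] = meas
  have bd: "bdd_above A" "bdd_below B"
    using bdd bounded_imp_bdd_above bounded_imp_bdd_below by auto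
  have up: "x \<le> Sup A" if "x \<in> A" for x
    using that bd(1) by (rule cSup_upper)
  have low: "Inf B \<le> x" if "x \<in> B" for x
    using that bd(2) by (rule cInf_lower)
  obtain a where a: "a \<in> A" "Sup A - e / 2 < a"
    using less_cSup_iff[OF ne(1) bd(1), of "Sup A - e / 2"] e by auto
  obtain b where b: "b \<in> B" "b < Inf B + e / 2"
    using cInf_less_iff[OF ne(2) bd(2), of "Inf B + e / 2"] e by auto
  have im: "(+) c ` X \<in> sets borel" if "X \<in> sets borel" for c :: real and X
  proof -
    have "(+) c ` X = (\<lambda>x. x - c) -` X \<inter> space borel"
      by (auto simp: image_iff) (metis add.commute diff_add_cancel)
    then show ?thesis using that by (auto intro!: measurable_sets_borel[where M=borel])
  qed
  have shift: "emeasure lborel ((+) c ` X) = emeasure lborel X" if "X \<in> sets borel" for c :: real and X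
  proof -
    have "(+) c ` X = (\<lambda>x. 1 *\<^sub>R x + c) ` X" by (auto simp: add.commute)
    then show ?thesis
      using emeasure_lebesgue_affine[of 1 c X] im[OF that, of c] that by simp
  qed
  let ?A = "(+) b ` (A \<inter> {..<a})" and ?B = "(+) a ` (B \<inter> {b..})"
  have "emeasure lborel A \<le> emeasure lborel (A \<inter> {..<a}) + emeasure lborel {a..Sup A}"
    by (intro order_trans[OF emeasure_mono emeasure_subadditive]) (use up in \<open>auto simp: not_less\<close>)
  also have "\<dots> \<le> emeasure lborel (A \<inter> {..<a}) + ennreal (e / 2)"
    using a e by (intro add_left_mono) (auto simp: emeasure_lborel_Icc_eq intro!: ennreal_leI)
  finally have 1: "emeasure lborel A \<le> emeasure lborel (A \<inter> {..<a}) + ennreal (e / 2)" .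
  have "emeasure lborel B \<le> emeasure lborel (B \<inter> {b..}) + emeasure lborel {Inf B..b}"
    by (intro order_trans[OF emeasure_mono emeasure_subadditive]) (use low in \<open>auto simp: not_le\<close>)
  also have "\<dots> \<le> emeasure lborel (B \<inter> {b..}) + ennreal (e / 2)"
    using b e by (intro add_left_mono) (auto simp: emeasure_lborel_Icc_eq intro!: ennreal_leI)
  finally have 2: "emeasure lborel B \<le> emeasure lborel (B \<inter> {b..}) + ennreal (e / 2)" .
  have "emeasure lborel (A \<inter> {..<a}) + emeasure lborel (B \<inter> {b..}) = emeasure lborel ?A + emeasure lborel ?B"
    by (subst (1 2) shift) auto
  also have "\<dots> = emeasure lborel (?A \<union> ?B)"
    by (intro plus_emeasure) (auto intro!: im)
  also have "\<dots> \<le> emeasure lborel C"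
    using sub[OF _ b(1)] sub[OF a(1)] meas by (intro emeasure_mono) (auto simp: add.commute[of b])
  finally have 3: "emeasure lborel (A \<inter> {..<a}) + emeasure lborel (B \<inter> {b..}) \<le> emeasure lborel C" .
  have "emeasure lborel A + emeasure lborel B
      \<le> (emeasure lborel (A \<inter> {..<a}) + emeasure lborel (B \<inter> {b..})) + (ennreal (e / 2) + ennreal (e / 2))"
    using add_mono[OF 1 2] by (simp add: algebra_simps)
  also have "ennreal (e / 2) + ennreal (e / 2) = ennreal e"
    using e by (simp flip: ennreal_plus)
  finally show "emeasure lborel A + emeasure lborel B \<le> emeasure lborel C + ennreal e"
    using add_right_mono[OF 3] order_trans by blast
qed

text \<open>
  Fubini's theorem for the region between the graph of \<open>f\<close> and the axis.
\<close>
lemma nn_integral_eq_level_sets: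
  fixes f :: "real \<Rightarrow> real"
  assumes [measurable]: "f \<in> borel_measurable borel"
  shows "(\<integral>\<^sup>+x. ennreal (f x) \<partial>lborel)
    = (\<integral>\<^sup>+\<sigma>. indicator {0<..} \<sigma> * emeasure lborel {x. \<sigma> < f x} \<partial>lborel)"
proof -
  let ?i = "\<lambda>x \<sigma>. indicator {(x, \<sigma>). 0 < \<sigma> \<and> \<sigma> < f x} (x, \<sigma>) :: ennreal"
  have "(\<integral>\<^sup>+x. ennreal (f x) \<partial>lborel) = (\<integral>\<^sup>+x. (\<integral>\<^sup>+\<sigma>. ?i x \<sigma> \<partial>lborel) \<partial>lborel)"
  proof (intro nn_integral_cong)
    fix x
    have "(\<integral>\<^sup>+\<sigma>. ?i x \<sigma> \<partial>lborel) = (\<integral>\<^sup>+\<sigma>. indicator {0<..<f x} \<sigma> \<partial>lborel)"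
      by (intro nn_integral_cong) (auto simp: indicator_def)
    also have "\<dots> = ennreal (f x)"
      by (cases "0 \<le> f x") (auto simp: ennreal_neg)
    finally show "ennreal (f x) = (\<integral>\<^sup>+\<sigma>. ?i x \<sigma> \<partial>lborel)" by simp
  qed
  also have "\<dots> = (\<integral>\<^sup>+\<sigma>. (\<integral>\<^sup>+x. ?i x \<sigma> \<partial>lborel) \<partial>lborel)"
    by (rule lborel_pair.Fubini'[symmetric]) measurable
  also have "\<dots> = (\<integral>\<^sup>+\<sigma>. indicator {0<..} \<sigma> * emeasure lborel {x. \<sigma> < f x} \<partial>lborel)"
  proof (intro nn_integral_cong)
    fix \<sigma> :: real
    have "(\<integral>\<^sup>+x. ?i x \<sigma> \<partial>lborel) = (\<integral>\<^sup>+x. indicator {0<..} \<sigma> * indicator {x. \<sigma> < f x} x \<partial>lborel)"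
      by (intro nn_integral_cong) (auto simp: indicator_def)
    then show "(\<integral>\<^sup>+x. ?i x \<sigma> \<partial>lborel) = indicator {0<..} \<sigma> * emeasure lborel {x. \<sigma> < f x}"
      by (simp add: nn_integral_cmult)
  qed
  finally show ?thesis .
qed

lemma exists_pos_if_integral_pos:
  fixes f :: "'a \<Rightarrow> real"
  assumes "0 < integral\<^sup>L M f"
  shows "\<exists>x. 0 < f x"
proof (rule ccontr)
  assume "\<not> ?thesis"
  then have "integral\<^sup>L M f \<le> 0"
    using integral_nonneg_AE[of "\<lambda>x. - f x" M] by (simp add: not_less)
  then show False using assms by simp
qed

section \<open>The inequality on the real line\<close>

text \<open>
  Divide \<open>F\<close> and \<open>G\<close> by their suprema \<open>A\<close>, \<open>B\<close> and \<open>H\<close> by \<open>M = psum s A B\<close>.  After this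
  normalisation the hypothesis puts the sum of the level sets of \<open>F\<close> and \<open>G\<close> at any
  height \<open>\<sigma>\<close> into the level set of \<open>H\<close> at the same height, and for \<open>\<sigma> < 1\<close> both summands
  are nonempty, so the one-dimensional Brunn-Minkowski inequality applies.  Integrating
  over \<open>\<sigma>\<close> gives \<open>\<integral>F / A + \<integral>G / B \<le> \<integral>H / M\<close>, and Hoelder's inequality removes \<open>A\<close> and \<open>B\<close>.
\<close>
lemma integral_ge_psum_real:
  fixes F G H :: "real \<Rightarrow> real"
  assumes s: "0 \<le> s"
    and integrable: "integrable lborel F" "integrable lborel G" "integrable lborel H"
    and nonneg: "\<And>x. 0 \<le> F x" "\<And>x. 0 \<le> G x" "\<And>x. 0 \<le> H x"
    and bdd: "bdd_above (range F)" "bdd_above (range G)"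
    and supp: "bounded (supp F)" "bounded (supp G)"
    and pos: "0 < integral\<^sup>L lborel F" "0 < integral\<^sup>L lborel G"
    and cond: "\<And>x y. 0 < F x \<Longrightarrow> 0 < G y \<Longrightarrow> psum s (F x) (G y) \<le> H (x + y)"
  shows "psum (s + 1) (integral\<^sup>L lborel F) (integral\<^sup>L lborel G) \<le> integral\<^sup>L lborel H"
proof -
  have [measurable]: "F \<in> borel_measurable borel" "G \<in> borel_measurable borel" "H \<in> borel_measurable borel"
    using integrable[THEN borel_measurable_integrable] by simp_all
  define A B where "A = (SUP x. F x)" and "B = (SUP x. G x)"
  have sup_pos: "0 < (SUP x. f x)"
    if f: "bdd_above (range f)" "0 < integral\<^sup>L lborel f" for f :: "real \<Rightarrow> real"
    using exists_pos_if_integral_pos[OF f(2)] cSUP_upper[OF UNIV_I f(1)] by (auto intro: less_le_trans)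
  have A: "0 < A" and B: "0 < B"
    using sup_pos bdd pos by (auto simp: A_def B_def)
  have le: "F x \<le> A" "G x \<le> B" for x
    using bdd by (auto simp: A_def B_def intro: cSUP_upper)
  define M where "M = psum s A B"
  have M: "0 < M" using A B by (simp add: M_def psum_pos)
  let ?m = "\<lambda>f c \<sigma>. indicator {0<..} \<sigma> * emeasure lborel {x. \<sigma> < f x / (c::real)}"
  have meas: "(\<lambda>\<sigma>. ?m f c \<sigma>) \<in> borel_measurable lborel"
    if [measurable]: "f \<in> borel_measurable borel" for f :: "real \<Rightarrow> real" and c
  proof -
    have "{p \<in> space (lborel \<Otimes>\<^sub>M lborel). fst p < f (snd p) / c} \<in> sets (lborel \<Otimes>\<^sub>M lborel)"
      by measurable
    also have "{p \<in> space (lborel \<Otimes>\<^sub>M lborel). fst p < f (snd p) / c} = {(\<sigma>, x). \<sigma> < f x / c}"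
      by (auto simp: space_pair_measure)
    finally have "(\<lambda>\<sigma>. emeasure lborel (Pair \<sigma> -` {(\<sigma>, x). \<sigma> < f x / c})) \<in> borel_measurable lborel"
      by (rule lborel.measurable_emeasure_Pair)
    then show ?thesis by simp
  qed
  have level: "?m F A \<sigma> + ?m G B \<sigma> \<le> ?m H M \<sigma>" for \<sigma>
  proof (cases "0 < \<sigma> \<and> \<sigma> < 1")
    case True
    have "emeasure lborel {x. \<sigma> < F x / A} + emeasure lborel {x. \<sigma> < G x / B}
        \<le> emeasure lborel {x. \<sigma> < H x / M}"
    proof (rule emeasure_sumset_ge)
      have "\<exists>x. \<sigma> * A < F x" "\<exists>x. \<sigma> * B < G x"
        using less_cSUP_iff[OF _ bdd(1), of "\<sigma> * A"] less_cSUP_iff[OF _ bdd(2), of "\<sigma> * B"] True A B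
        by (auto simp: A_def B_def)
      then show "{x. \<sigma> < F x / A} \<noteq> {}" "{x. \<sigma> < G x / B} \<noteq> {}"
        using A B by (auto simp: field_simps)
      have "0 < F x" if "\<sigma> < F x / A" for x
        using that True A by (smt (verit) divide_nonpos_pos)
      then show "bounded {x. \<sigma> < F x / A}"
        by (intro bounded_subset[OF supp(1)]) (auto simp: supp_def)
      have "0 < G x" if "\<sigma> < G x / B" for x
        using that True B by (smt (verit) divide_nonpos_pos)
      then show "bounded {x. \<sigma> < G x / B}"
        by (intro bounded_subset[OF supp(2)]) (auto simp: supp_def)
      show "x + y \<in> {x. \<sigma> < H x / M}" if "x \<in> {x. \<sigma> < F x / A}" "y \<in> {x. \<sigma> < G x / B}" for x y
      proof -
        have lt: "\<sigma> * A < F x" "\<sigma> * B < G y" using that A B by (auto simp: field_simps)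
        moreover have "0 < \<sigma> * A" "0 < \<sigma> * B" using True A B by simp_all
        ultimately have pos: "0 < F x" "0 < G y" by linarith+
        have "\<sigma> * M = psum s (\<sigma> * A) (\<sigma> * B)"
          using True A B s by (simp add: psum_mult_left M_def)
        also have "\<dots> < psum s (F x) (G y)"
          using True A B s lt by (intro psum_strict_mono) auto
        also have "\<dots> \<le> H (x + y)" using pos by (rule cond)
        finally show ?thesis using M by (simp add: field_simps)
      qed
    qed measurable
    then show ?thesis using True by simp
  next
    case False
    have "{x. \<sigma> < F x / A} = {}" "{x. \<sigma> < G x / B} = {}" if "1 \<le> \<sigma>"
    proof -
      have "F x / A \<le> 1" "G x / B \<le> 1" for x using le A B by simp_all
      then show "{x. \<sigma> < F x / A} = {}" "{x. \<sigma> < G x / B} = {}"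
        using that by (auto simp: not_less intro: order_trans)
    qed
    then show ?thesis using False by (cases "1 \<le> \<sigma>") auto
  qed
  have nn: "(\<integral>\<^sup>+x. ennreal (f x / c) \<partial>lborel) = ennreal (integral\<^sup>L lborel f / c)"
    if "integrable lborel f" "\<And>x. 0 \<le> f x" "0 < c" for f :: "real \<Rightarrow> real" and c
    using that by (subst nn_integral_eq_integral) auto
  have "ennreal (integral\<^sup>L lborel F / A) + ennreal (integral\<^sup>L lborel G / B)
      = (\<integral>\<^sup>+\<sigma>. ?m F A \<sigma> \<partial>lborel) + (\<integral>\<^sup>+\<sigma>. ?m G B \<sigma> \<partial>lborel)"
    using A B integrable nonneg by (simp add: nn[symmetric] nn_integral_eq_level_sets)
  also have "\<dots> = (\<integral>\<^sup>+\<sigma>. ?m F A \<sigma> + ?m G B \<sigma> \<partial>lborel)"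
    by (intro nn_integral_add[symmetric] meas) measurable
  also have "\<dots> \<le> (\<integral>\<^sup>+\<sigma>. ?m H M \<sigma> \<partial>lborel)"
    by (intro nn_integral_mono level)
  also have "\<dots> = ennreal (integral\<^sup>L lborel H / M)"
    using M integrable nonneg by (simp add: nn[symmetric] nn_integral_eq_level_sets)
  finally have "integral\<^sup>L lborel F / A + integral\<^sup>L lborel G / B \<le> integral\<^sup>L lborel H / M"
    using pos A B M nonneg by (simp add: integral_nonneg_AE flip: ennreal_plus)
  then have "M * (integral\<^sup>L lborel F / A + integral\<^sup>L lborel G / B) \<le> integral\<^sup>L lborel H"
    using M by (simp add: field_simps)
  then show ?thesis
    using psum_Hoelder[OF s A B pos] by (simp add: M_def)
qed

section \<open>Induction on the number of coordinates\<close>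

text \<open>
  A class of functions of the coordinates in \<open>I\<close> that is closed under restriction to
  lines and under integration over one coordinate, and on which all integrals are
  finite.  Boundedness alone would be lost by integrating over a line; the bounded
  support preserves it.
\<close>
definition box_bounded :: "'i set \<Rightarrow> (('i \<Rightarrow> real) \<Rightarrow> real) \<Rightarrow> bool" where
  "box_bounded I F \<longleftrightarrow> F \<in> borel_measurable (Pi\<^sub>M I (\<lambda>_. lborel)) \<and>
    (\<exists>K R. 0 \<le> R \<and> (\<forall>x \<in> I \<rightarrow>\<^sub>E UNIV. 0 \<le> F x \<and> F x \<le> K \<and> (F x \<noteq> 0 \<longrightarrow> (\<forall>i\<in>I. \<bar>x i\<bar> \<le> R))))"

lemma box_bounded_integrable:
  assumes "finite I" "box_bounded I F"
  shows "integrable (Pi\<^sub>M I (\<lambda>_. lborel)) F"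
proof -
  interpret product_sigma_finite "\<lambda>_. lborel :: real measure" by standard
  obtain K R where F: "\<And>x. x \<in> I \<rightarrow>\<^sub>E UNIV \<Longrightarrow> 0 \<le> F x \<and> F x \<le> K \<and> (F x \<noteq> 0 \<longrightarrow> (\<forall>i\<in>I. \<bar>x i\<bar> \<le> R))"
    using assms unfolding box_bounded_def by blast
  show ?thesis
  proof (rule integrableI_bounded_set)
    show "Pi\<^sub>E I (\<lambda>_. {-R..R}) \<in> sets (Pi\<^sub>M I (\<lambda>_. lborel))"
      using assms(1) by (intro sets_PiM_I_finite) auto
    show "emeasure (Pi\<^sub>M I (\<lambda>_. lborel)) (Pi\<^sub>E I (\<lambda>_. {-R..R})) < \<infinity>"
      using assms(1) by (subst emeasure_PiM) (auto simp: emeasure_lborel_Icc_eq ennreal_power less_top)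
    show "AE x in Pi\<^sub>M I (\<lambda>_. lborel). x \<in> Pi\<^sub>E I (\<lambda>_. {-R..R}) \<longrightarrow> norm (F x) \<le> K"
      using F by (intro AE_I2) (auto simp: space_PiM)
    show "AE x in Pi\<^sub>M I (\<lambda>_. lborel). x \<notin> Pi\<^sub>E I (\<lambda>_. {-R..R}) \<longrightarrow> F x = 0"
      using F by (intro AE_I2) (force simp: space_PiM PiE_iff abs_le_iff)
  qed (use assms in \<open>simp add: box_bounded_def\<close>)
qed

lemma box_bounded_slice:
  assumes F: "box_bounded (insert i I) F" and i: "i \<notin> I" and x: "x \<in> I \<rightarrow>\<^sub>E UNIV"
  shows "integrable lborel (\<lambda>y. F (x(i := y)))"
    and "\<And>y. 0 \<le> F (x(i := y))"
    and "bdd_above (range (\<lambda>y. F (x(i := y))))"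
    and "bounded (supp (\<lambda>y. F (x(i := y))))"
proof -
  obtain K R where K: "\<And>x. x \<in> insert i I \<rightarrow>\<^sub>E UNIV \<Longrightarrow>
      0 \<le> F x \<and> F x \<le> K \<and> (F x \<noteq> 0 \<longrightarrow> (\<forall>i\<in>insert i I. \<bar>x i\<bar> \<le> R))"
    using F unfolding box_bounded_def by blast
  have Fm: "F \<in> borel_measurable (Pi\<^sub>M (insert i I) (\<lambda>_. lborel))"
    using F by (simp add: box_bounded_def)
  have upd: "x(i := y) \<in> insert i I \<rightarrow>\<^sub>E UNIV" for y
    using x by (auto simp: PiE_iff extensional_def)
  have K': "0 \<le> F (x(i := y))" "F (x(i := y)) \<le> K" "F (x(i := y)) \<noteq> 0 \<Longrightarrow> \<bar>y\<bar> \<le> R" for y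
    using K[OF upd, of y] by auto
  have m: "(\<lambda>y. x(i := y)) \<in> measurable lborel (Pi\<^sub>M (insert i I) (\<lambda>_. lborel))"
    using x i measurable_component_update[of x I "\<lambda>_. lborel" i] by (simp add: space_PiM)
  have meas: "(\<lambda>y. F (x(i := y))) \<in> borel_measurable borel"
    using measurable_compose[OF m, of F borel] Fm by simp
  show "integrable lborel (\<lambda>y. F (x(i := y)))"
    by (rule integrableI_bounded_set[where A = "{-R..R}" and B = K])
      (use K' meas in \<open>auto simp: emeasure_lborel_Icc_eq abs_le_iff intro!: AE_I2\<close>, force+)
  show "\<And>y. 0 \<le> F (x(i := y))" by (rule K')
  show "bdd_above (range (\<lambda>y. F (x(i := y))))"
    using K' by (intro bdd_aboveI[of _ K]) auto
  show "bounded (supp (\<lambda>y. F (x(i := y))))"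
  proof (rule bounded_subset[OF bounded_closed_interval[of "-R" R]])
    show "supp (\<lambda>y. F (x(i := y))) \<subseteq> {-R..R}"
      using K'(3) unfolding supp_def abs_le_iff by (fastforce simp: minus_le_iff)
  qed
qed

lemma box_bounded_integral:
  assumes F: "box_bounded (insert i I) F" and i: "i \<notin> I"
  shows "box_bounded I (\<lambda>x. \<integral>y. F (x(i := y)) \<partial>lborel)"
proof -
  obtain K R where R: "0 \<le> R" and K: "\<And>x. x \<in> insert i I \<rightarrow>\<^sub>E UNIV \<Longrightarrow>
      0 \<le> F x \<and> F x \<le> K \<and> (F x \<noteq> 0 \<longrightarrow> (\<forall>i\<in>insert i I. \<bar>x i\<bar> \<le> R))"
    using F unfolding box_bounded_def by blast
  have Fm: "F \<in> borel_measurable (Pi\<^sub>M (insert i I) (\<lambda>_. lborel))"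
    using F by (simp add: box_bounded_def)
  have "(\<lambda>(x, y). F (x(i := y))) \<in> borel_measurable (Pi\<^sub>M I (\<lambda>_. lborel) \<Otimes>\<^sub>M lborel)"
    using measurable_compose[OF measurable_add_dim[of i I "\<lambda>_. lborel"], of F borel] Fm
    by (simp add: case_prod_beta')
  then have meas: "(\<lambda>x. \<integral>y. F (x(i := y)) \<partial>lborel) \<in> borel_measurable (Pi\<^sub>M I (\<lambda>_. lborel))"
    by (rule lborel.borel_measurable_lebesgue_integral)
  have "0 \<le> (\<integral>y. F (x(i := y)) \<partial>lborel) \<and> (\<integral>y. F (x(i := y)) \<partial>lborel) \<le> K * (2 * R)
      \<and> ((\<integral>y. F (x(i := y)) \<partial>lborel) \<noteq> 0 \<longrightarrow> (\<forall>i\<in>I. \<bar>x i\<bar> \<le> R))" if x: "x \<in> I \<rightarrow>\<^sub>E UNIV" for x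
  proof -
    have upd: "x(i := y) \<in> insert i I \<rightarrow>\<^sub>E UNIV" for y
      using x by (auto simp: PiE_iff extensional_def)
    have K': "0 \<le> F (x(i := y))" "F (x(i := y)) \<le> K"
      "F (x(i := y)) \<noteq> 0 \<Longrightarrow> \<bar>y\<bar> \<le> R \<and> (\<forall>i\<in>I. \<bar>x i\<bar> \<le> R)" for y
      using K[OF upd, of y] i by (auto split: if_splits)
    have "(\<integral>y. F (x(i := y)) \<partial>lborel) \<le> (\<integral>y. K * indicator {-R..R} y \<partial>lborel)"
    proof (rule integral_mono)
      show "integrable lborel (\<lambda>y. F (x(i := y)))"
        using F i x by (rule box_bounded_slice)
      show "integrable lborel (\<lambda>y. K * indicator {-R..R} y :: real)"
        by (intro integrable_mult_right integrable_real_indicator) (auto simp: emeasure_lborel_Icc_eq)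
      show "F (x(i := y)) \<le> K * indicator {-R..R} y" for y
        using K'(1,2)[of y] K'(3)[of y] by (cases "F (x(i := y)) = 0") (auto simp: indicator_def abs_le_iff)
    qed
    also have "\<dots> = K * (2 * R)"
      using R by simp
    moreover have "F (x(i := y)) = 0" if "\<not> (\<forall>i\<in>I. \<bar>x i\<bar> \<le> R)" for y
      using K'(3)[of y] that by blast
    then have "(\<integral>y. F (x(i := y)) \<partial>lborel) = 0" if "\<not> (\<forall>i\<in>I. \<bar>x i\<bar> \<le> R)"
      using that by simp
    ultimately show ?thesis
      using K'(1) by (auto intro: integral_nonneg_AE)
  qed
  with meas R show ?thesis unfolding box_bounded_def by blast
qed

text \<open>
  Integrate over one coordinate at a time.  The one-dimensional inequality on two lines
  parallel to the \<open>i\<close>-axis shows that the functions obtained by integrating over the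
  coordinate \<open>i\<close> satisfy the same hypothesis in the remaining coordinates, with \<open>s + 1\<close>
  in place of \<open>s\<close>.
\<close>
lemma integral_ge_psum_PiM:
  fixes F G H :: "('i \<Rightarrow> real) \<Rightarrow> real"
  assumes "finite I" "0 \<le> s"
    and "box_bounded I F" "box_bounded I G" "box_bounded I H"
    and "0 < (\<integral>x. F x \<partial>Pi\<^sub>M I (\<lambda>_. lborel))" "0 < (\<integral>x. G x \<partial>Pi\<^sub>M I (\<lambda>_. lborel))"
    and "\<And>x y. x \<in> I \<rightarrow>\<^sub>E UNIV \<Longrightarrow> y \<in> I \<rightarrow>\<^sub>E UNIV \<Longrightarrow> 0 < F x \<Longrightarrow> 0 < G y \<Longrightarrow>
      psum s (F x) (G y) \<le> H (\<lambda>i\<in>I. x i + y i)"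
  shows "psum (s + real (card I)) (\<integral>x. F x \<partial>Pi\<^sub>M I (\<lambda>_. lborel)) (\<integral>x. G x \<partial>Pi\<^sub>M I (\<lambda>_. lborel))
      \<le> (\<integral>x. H x \<partial>Pi\<^sub>M I (\<lambda>_. lborel))"
  using assms
proof (induction I arbitrary: s F G H rule: finite_induct)
  case empty
  interpret product_sigma_finite "\<lambda>_. lborel :: real measure" by standard
  have space: "(\<lambda>_. undefined) \<in> {} \<rightarrow>\<^sub>E (UNIV :: real set)" by simp
  have int: "(\<integral>x. f x \<partial>Pi\<^sub>M {} (\<lambda>_. lborel :: real measure)) = f (\<lambda>_. undefined)" for f :: "('i \<Rightarrow> real) \<Rightarrow> real"
    by (simp add: PiM_empty lebesgue_integral_count_space_finite)
  show ?case
    using empty.prems(7)[OF space space] empty.prems(5,6) by (simp add: int restrict_def)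
next
  case (insert i I)
  interpret product_sigma_finite "\<lambda>_. lborel :: real measure" by standard
  let ?S = "\<lambda>F x. \<integral>y. F (x(i := y)) \<partial>lborel"
  note prems = insert.prems
  have fub: "(\<integral>x. F x \<partial>Pi\<^sub>M (insert i I) (\<lambda>_. lborel)) = (\<integral>x. ?S F x \<partial>Pi\<^sub>M I (\<lambda>_. lborel))"
    if "box_bounded (insert i I) F" for F
    using insert.hyps that by (intro product_integral_insert box_bounded_integrable) auto
  have upd: "x(i := r) \<in> insert i I \<rightarrow>\<^sub>E UNIV" if "x \<in> I \<rightarrow>\<^sub>E UNIV" for x and r :: real
    using that by (auto simp: PiE_iff extensional_def)
  have "psum ((s + 1) + real (card I)) (\<integral>x. ?S F x \<partial>Pi\<^sub>M I (\<lambda>_. lborel)) (\<integral>x. ?S G x \<partial>Pi\<^sub>M I (\<lambda>_. lborel))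
      \<le> (\<integral>x. ?S H x \<partial>Pi\<^sub>M I (\<lambda>_. lborel))"
  proof (rule insert.IH)
    show "0 \<le> s + 1" using prems by simp
    show "box_bounded I (?S F)" "box_bounded I (?S G)" "box_bounded I (?S H)"
      using prems insert.hyps by (auto intro: box_bounded_integral)
    show "0 < (\<integral>x. ?S F x \<partial>Pi\<^sub>M I (\<lambda>_. lborel))" "0 < (\<integral>x. ?S G x \<partial>Pi\<^sub>M I (\<lambda>_. lborel))"
      using prems by (simp_all add: fub)
    fix x y assume x: "x \<in> I \<rightarrow>\<^sub>E (UNIV :: real set)" and y: "y \<in> I \<rightarrow>\<^sub>E (UNIV :: real set)"
      and pos: "0 < ?S F x" "0 < ?S G y"
    have xy: "(\<lambda>j\<in>I. x j + y j) \<in> I \<rightarrow>\<^sub>E UNIV" by simp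
    note F = box_bounded_slice[OF prems(2) insert.hyps(2) x]
    note G = box_bounded_slice[OF prems(3) insert.hyps(2) y]
    note H = box_bounded_slice[OF prems(4) insert.hyps(2) xy]
    show "psum (s + 1) (?S F x) (?S G y) \<le> ?S H (\<lambda>j\<in>I. x j + y j)"
    proof (rule integral_ge_psum_real[OF prems(1) F(1) G(1) H(1) F(2) G(2) H(2) F(3) G(3) F(4) G(4) pos])
      fix u v assume uv: "0 < F (x(i := u))" "0 < G (y(i := v))"
      have "(\<lambda>j\<in>insert i I. (x(i := u)) j + (y(i := v)) j) = (\<lambda>j\<in>I. x j + y j)(i := u + v)"
        by (auto simp: fun_eq_iff)
      then show "psum s (F (x(i := u))) (G (y(i := v))) \<le> H ((\<lambda>j\<in>I. x j + y j)(i := u + v))"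
        using prems(7)[OF upd[OF x] upd[OF y] uv] by (simp only:)
    qed
  qed
  then show ?case
    using insert.hyps prems by (simp add: fub algebra_simps)
qed

section \<open>Euclidean spaces, unbounded supports and Lebesgue measurable functions\<close>

lemma integral_ge_psum_lborel_bounded_support:
  fixes F G H :: "'a::euclidean_space \<Rightarrow> real"
  assumes s: "0 \<le> s"
    and meas: "F \<in> borel_measurable borel" "G \<in> borel_measurable borel" "H \<in> borel_measurable borel"
    and nonneg: "\<And>x. 0 \<le> F x" "\<And>x. 0 \<le> G x" "\<And>x. 0 \<le> H x"
    and bdd: "bdd_above (range F)" "bdd_above (range G)" "bdd_above (range H)"
    and supp: "bounded (supp F)" "bounded (supp G)" "bounded (supp H)"
    and pos: "0 < integral\<^sup>L lborel F" "0 < integral\<^sup>L lborel G"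
    and cond: "\<And>x y. 0 < F x \<Longrightarrow> 0 < G y \<Longrightarrow> psum s (F x) (G y) \<le> H (x + y)"
  shows "psum (s + real DIM('a)) (integral\<^sup>L lborel F) (integral\<^sup>L lborel G) \<le> integral\<^sup>L lborel H"
proof -
  define T :: "('a \<Rightarrow> real) \<Rightarrow> 'a" where "T u = (\<Sum>b\<in>Basis. u b *\<^sub>R b)" for u
  have T_meas [measurable]: "T \<in> borel_measurable (Pi\<^sub>M Basis (\<lambda>_. lborel))"
    unfolding T_def by measurable
  have lborel: "lborel = distr (Pi\<^sub>M Basis (\<lambda>_. lborel)) borel T"
    by (simp add: lborel_eq[where 'a='a] T_def[abs_def])
  have int: "integral\<^sup>L lborel f = (\<integral>u. f (T u) \<partial>Pi\<^sub>M Basis (\<lambda>_. lborel))"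
    if "f \<in> borel_measurable borel" for f :: "'a \<Rightarrow> real"
    unfolding lborel using that by (subst integral_distr) auto
  have coord: "T u \<bullet> b = u b" if "b \<in> Basis" for u b
    using that by (simp add: T_def inner_sum_left inner_Basis if_distrib sum.If_cases cong: if_cong)
  have box: "box_bounded Basis (\<lambda>u. f (T u))"
    if f: "f \<in> borel_measurable borel" "\<And>x. 0 \<le> f x" "bdd_above (range f)" "bounded (supp f)" for f
  proof -
    obtain K where K: "\<And>x. f x \<le> K" using f(3) by (auto simp: bdd_above_def)
    obtain R where R: "0 < R" "\<And>x. x \<in> supp f \<Longrightarrow> norm x \<le> R" using f(4) by (auto simp: bounded_pos)
    have "\<bar>u b\<bar> \<le> R" if "f (T u) \<noteq> 0" "b \<in> Basis" for u b
    proof -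
      have "norm (T u) \<le> R" using that f(2)[of "T u"] by (intro R) (simp add: supp_def)
      then show ?thesis using Basis_le_norm[of b "T u"] that by (simp add: coord)
    qed
    moreover have "(\<lambda>u. f (T u)) \<in> borel_measurable (Pi\<^sub>M Basis (\<lambda>_. lborel))"
      using f(1) T_meas by (rule measurable_compose[rotated])
    ultimately show ?thesis
      using K R(1) f(2) unfolding box_bounded_def by (intro conjI exI[of _ K] exI[of _ R]) auto
  qed
  have add: "T (\<lambda>i\<in>Basis. u i + v i) = T u + T v" for u v
    by (simp add: T_def scaleR_add_left sum.distrib)
  show ?thesis
    unfolding int[OF meas(1)] int[OF meas(2)] int[OF meas(3)]
  proof (rule integral_ge_psum_PiM)
    show "0 < (\<integral>u. F (T u) \<partial>Pi\<^sub>M Basis (\<lambda>_. lborel))" "0 < (\<integral>u. G (T u) \<partial>Pi\<^sub>M Basis (\<lambda>_. lborel))"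
      using pos by (simp_all add: int meas)
  qed (use s cond in \<open>auto simp: add intro!: box meas nonneg bdd supp\<close>)
qed

text \<open>
  Cut \<open>F\<close> and \<open>G\<close> off outside the ball of radius \<open>k\<close> and \<open>H\<close> outside the ball of radius
  \<open>2 k\<close>, which contains the sum of two balls of radius \<open>k\<close>, so that the hypothesis
  survives.  Then let \<open>k\<close> tend to infinity.
\<close>
lemma integral_ge_psum_lborel:
  fixes F G H :: "'a::euclidean_space \<Rightarrow> real"
  assumes s: "0 \<le> s"
    and integrable: "integrable lborel F" "integrable lborel G" "integrable lborel H"
    and nonneg: "\<And>x. 0 \<le> F x" "\<And>x. 0 \<le> G x" "\<And>x. 0 \<le> H x"
    and bdd: "bdd_above (range F)" "bdd_above (range G)" "bdd_above (range H)"
    and pos: "0 < integral\<^sup>L lborel F" "0 < integral\<^sup>L lborel G"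
    and cond: "\<And>x y. 0 < F x \<Longrightarrow> 0 < G y \<Longrightarrow> psum s (F x) (G y) \<le> H (x + y)"
  shows "psum (s + real DIM('a)) (integral\<^sup>L lborel F) (integral\<^sup>L lborel G) \<le> integral\<^sup>L lborel H"
proof -
  have [measurable]: "F \<in> borel_measurable borel" "G \<in> borel_measurable borel" "H \<in> borel_measurable borel"
    using integrable[THEN borel_measurable_integrable] by simp_all
  define cut where "cut f r x = indicator (cball 0 r) x * f x" for f :: "'a \<Rightarrow> real" and r x
  have cut: "0 \<le> cut f r x" "cut f r x \<le> f x" "0 < cut f r x \<longleftrightarrow> norm x \<le> r \<and> 0 < f x"
    if "0 \<le> f x" for f r x
    using that by (auto simp: cut_def indicator_def)
  have meas: "cut f r \<in> borel_measurable borel" if "f \<in> borel_measurable borel" for f r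
    unfolding cut_def by (intro borel_measurable_times borel_measurable_indicator that) simp
  have bdd_cut: "bdd_above (range (cut f r))" if f: "bdd_above (range f)" "\<And>x. 0 \<le> f x" for f r
  proof -
    obtain K where "\<And>x. f x \<le> K" using f(1) by (auto simp: bdd_above_def)
    then have "cut f r x \<le> K" for x using cut(2)[of f, OF f(2)] by (rule order_trans[rotated])
    then show ?thesis by (intro bdd_aboveI[of _ K]) auto
  qed
  have supp_cut: "bounded (supp (cut f r))" for f r
    by (rule bounded_subset[OF bounded_cball[of 0 r]]) (auto simp: supp_def cut_def indicator_def split: if_splits)
  have lim: "(\<lambda>k. integral\<^sup>L lborel (cut f (real k))) \<longlonglongrightarrow> integral\<^sup>L lborel f"
    if f: "integrable lborel f" "\<And>x. 0 \<le> f x" for f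
  proof (rule integral_dominated_convergence[where w = f])
    show "AE x in lborel. (\<lambda>k. cut f (real k) x) \<longlonglongrightarrow> f x"
    proof (rule AE_I2)
      fix x :: 'a
      obtain N :: nat where "norm x \<le> real N" using real_arch_simple by blast
      then have "\<forall>\<^sub>F k in sequentially. cut f (real k) x = f x"
        by (intro eventually_sequentiallyI[of N]) (auto simp: cut_def indicator_def)
      then show "(\<lambda>k. cut f (real k) x) \<longlonglongrightarrow> f x" by (rule tendsto_eventually)
    qed
    show "AE x in lborel. norm (cut f (real k) x) \<le> f x" for k
      using cut f(2) by auto
  qed (use f meas borel_measurable_integrable[OF f(1)] in auto)
  note limF = lim[OF integrable(1) nonneg(1)] and limG = lim[OF integrable(2) nonneg(2)]
  have "\<forall>\<^sub>F k in sequentially. psum (s + real DIM('a)) (integral\<^sup>L lborel (cut F (real k)))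
      (integral\<^sup>L lborel (cut G (real k))) \<le> integral\<^sup>L lborel H"
    using order_tendstoD(1)[OF limF pos(1)] order_tendstoD(1)[OF limG pos(2)]
  proof eventually_elim
    fix k :: nat
    assume k: "0 < integral\<^sup>L lborel (cut F (real k))" "0 < integral\<^sup>L lborel (cut G (real k))"
    have "psum (s + real DIM('a)) (integral\<^sup>L lborel (cut F (real k))) (integral\<^sup>L lborel (cut G (real k)))
        \<le> integral\<^sup>L lborel (cut H (2 * real k))"
    proof (rule integral_ge_psum_lborel_bounded_support[OF s _ _ _ _ _ _ _ _ _ _ _ _ k])
      fix x y assume "0 < cut F (real k) x" "0 < cut G (real k) y"
      then have xy: "norm x \<le> k" "norm y \<le> k" "0 < F x" "0 < G y"
        using cut(3) nonneg by auto
      then have "norm (x + y) \<le> 2 * real k" using norm_triangle_ineq[of x y] by linarith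
      then show "psum s (cut F (real k) x) (cut G (real k) y) \<le> cut H (2 * real k) (x + y)"
        using cond[OF xy(3,4)] xy by (simp add: cut_def)
    qed (auto intro!: meas supp_cut bdd_cut bdd cut(1) nonneg)
    also have "\<dots> \<le> integral\<^sup>L lborel H"
      using integrable cut[of H, OF nonneg(3)] by (intro integral_mono_AE') (auto intro: nonneg)
    finally show "psum (s + real DIM('a)) (integral\<^sup>L lborel (cut F (real k)))
      (integral\<^sup>L lborel (cut G (real k))) \<le> integral\<^sup>L lborel H" .
  qed
  moreover have "(\<lambda>k. psum (s + real DIM('a)) (integral\<^sup>L lborel (cut F (real k)))
      (integral\<^sup>L lborel (cut G (real k))))
      \<longlonglongrightarrow> psum (s + real DIM('a)) (integral\<^sup>L lborel F) (integral\<^sup>L lborel G)"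
    using s pos by (intro tendsto_psum limF limG) (auto simp: add_nonneg_pos)
  ultimately show ?thesis
    by (intro tendsto_upperbound) auto
qed

lemma lborel_integral_dilation:
  fixes f :: "'a::euclidean_space \<Rightarrow> real"
  assumes c: "0 < c" and f: "integrable lborel f"
  shows "integrable lborel (\<lambda>x. f (x /\<^sub>R c))"
    and "(\<integral>x. f (x /\<^sub>R c) \<partial>lborel) = c ^ DIM('a) * integral\<^sup>L lborel f"
proof -
  have [measurable]: "f \<in> borel_measurable borel"
    using f[THEN borel_measurable_integrable] by simp
  have lb: "lborel = density (distr lborel borel (\<lambda>x::'a. 0 + c *\<^sub>R x)) (\<lambda>_. ennreal (c ^ DIM('a)))"
    using c by (subst lborel_affine[of c 0]) auto
  show "integrable lborel (\<lambda>x. f (x /\<^sub>R c))"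
    by (subst lb, subst integrable_real_density)
      (use c f in \<open>auto simp: integrable_distr_eq\<close>)
  show "(\<integral>x. f (x /\<^sub>R c) \<partial>lborel) = c ^ DIM('a) * integral\<^sup>L lborel f"
    by (subst lb, subst integral_real_density) (use c in \<open>auto simp: integral_distr\<close>)
qed

text \<open>
  The coefficients \<open>c\<close> and \<open>d\<close> disappear on passing to \<open>x \<mapsto> c\<^sup>s f (x / c)\<close> and
  \<open>y \<mapsto> d\<^sup>s g (y / d)\<close>, whose integrals carry the additional factors \<open>c\<^bsup>s+n\<^esup>\<close> and \<open>d\<^bsup>s+n\<^esup>\<close>.
\<close>
lemma integral_ge_psum_scaled:
  fixes f g h :: "'a::euclidean_space \<Rightarrow> real"
  assumes s: "0 \<le> s" and cd: "0 < c" "0 < d"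
    and integrable: "integrable lborel f" "integrable lborel g" "integrable lborel h"
    and nonneg: "\<And>x. 0 \<le> f x" "\<And>x. 0 \<le> g x" "\<And>x. 0 \<le> h x"
    and bdd: "bdd_above (range f)" "bdd_above (range g)" "bdd_above (range h)"
    and pos: "0 < integral\<^sup>L lborel f" "0 < integral\<^sup>L lborel g"
    and cond: "\<And>x y. 0 < f x \<Longrightarrow> 0 < g y \<Longrightarrow>
      psum s (c powr s * f x) (d powr s * g y) \<le> h (c *\<^sub>R x + d *\<^sub>R y)"
  shows "psum (s + real DIM('a)) (c powr (s + real DIM('a)) * integral\<^sup>L lborel f)
      (d powr (s + real DIM('a)) * integral\<^sup>L lborel g) \<le> integral\<^sup>L lborel h"
proof -
  have dil: "integrable lborel (\<lambda>x. r powr s * k (x /\<^sub>R r))"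
    "(\<integral>x. r powr s * k (x /\<^sub>R r) \<partial>lborel) = r powr (s + real DIM('a)) * integral\<^sup>L lborel k"
    if "0 < r" "integrable lborel k" for r :: real and k :: "'a \<Rightarrow> real"
    using lborel_integral_dilation[OF that] that by (simp_all add: powr_add powr_realpow)
  have bdd_dil: "bdd_above (range (\<lambda>x. r powr s * k (x /\<^sub>R r)))"
    if k: "bdd_above (range k)" for r :: real and k :: "'a \<Rightarrow> real"
  proof -
    obtain K where "\<And>x. k x \<le> K" using k by (auto simp: bdd_above_def)
    then show ?thesis by (intro bdd_aboveI[of _ "r powr s * K"]) (auto intro: mult_left_mono)
  qed
  note F = dil[OF cd(1) integrable(1)] and G = dil[OF cd(2) integrable(2)]
  have "psum (s + real DIM('a)) (\<integral>x. c powr s * f (x /\<^sub>R c) \<partial>lborel) (\<integral>x. d powr s * g (x /\<^sub>R d) \<partial>lborel)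
      \<le> integral\<^sup>L lborel h"
  proof (rule integral_ge_psum_lborel[OF s F(1) G(1) integrable(3) _ _ nonneg(3) bdd_dil[OF bdd(1)] bdd_dil[OF bdd(2)] bdd(3)])
    fix x y assume "0 < c powr s * f (x /\<^sub>R c)" "0 < d powr s * g (y /\<^sub>R d)"
    then show "psum s (c powr s * f (x /\<^sub>R c)) (d powr s * g (y /\<^sub>R d)) \<le> h (x + y)"
      using cond[of "x /\<^sub>R c" "y /\<^sub>R d"] cd by (simp add: zero_less_mult_iff)
  qed (use cd nonneg pos in \<open>auto simp: F(2) G(2) simp del: integral_mult_right_zero\<close>)
  then show ?thesis by (simp only: F(2) G(2))
qed

text \<open>
  Lowering \<open>f\<close> and \<open>g\<close>, or raising \<open>h\<close>, preserves the hypothesis of the inequality.  So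
  the passage from Lebesgue to Borel measurable functions, which are the ones with
  measurable restrictions to lines, needs one-sided modifications on null sets.
\<close>
lemma borel_minorant:
  fixes f :: "'a::euclidean_space \<Rightarrow> real"
  assumes f: "f \<in> borel_measurable lebesgue" and nonneg: "\<And>x. 0 \<le> f x"
  obtains f' where "f' \<in> borel_measurable borel" "\<And>x. 0 \<le> f' x" "\<And>x. f' x \<le> f x"
    "AE x in lborel. f' x = f x"
proof -
  obtain f0 where f0: "f0 \<in> borel_measurable borel" and ae: "AE x in lborel. f x = f0 x"
    using completion_ex_borel_measurable_real[OF f] by auto
  obtain N where N: "N \<in> null_sets lborel" "{x. f x \<noteq> f0 x} \<subseteq> N"
    using ae by (auto elim!: AE_E simp: null_sets_def)
  have [measurable]: "N \<in> sets borel" using N by auto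
  have eq: "x \<notin> N \<Longrightarrow> f x = f0 x" for x using N by auto
  show ?thesis
  proof (rule that[of "\<lambda>x. if x \<in> N then 0 else f0 x"])
    show "(\<lambda>x. if x \<in> N then 0 else f0 x) \<in> borel_measurable borel"
      using f0 by measurable
    show "AE x in lborel. (if x \<in> N then 0 else f0 x) = f x"
      using AE_not_in[OF N(1)] by eventually_elim (simp add: eq)
  qed (use nonneg eq in \<open>auto simp flip: eq\<close>)
qed

text \<open>
  The bound \<open>K\<close> serves as the value on the exceptional null set.
\<close>
lemma borel_majorant:
  fixes f :: "'a::euclidean_space \<Rightarrow> real"
  assumes f: "f \<in> borel_measurable lebesgue" and K: "\<And>x. f x \<le> K"
  obtains f' where "f' \<in> borel_measurable borel" "\<And>x. f x \<le> f' x" "\<And>x. f' x \<le> K"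
    "AE x in lborel. f' x = f x"
proof -
  obtain k where k: "k \<in> borel_measurable borel" "\<And>x. 0 \<le> k x" "\<And>x. k x \<le> K - f x"
    "AE x in lborel. k x = K - f x"
    by (rule borel_minorant[of "\<lambda>x. K - f x"]) (use f K in auto)
  show ?thesis
  proof (rule that[of "\<lambda>x. K - k x"])
    show "AE x in lborel. K - k x = f x" using k(4) by eventually_elim simp
    show "f x \<le> K - k x" for x using k(3)[of x] by linarith
  qed (use k in auto)
qed

lemma lborel_integral_eq_lebesgue:
  fixes f f' :: "'a::euclidean_space \<Rightarrow> real"
  assumes f: "integrable lebesgue f" and f': "f' \<in> borel_measurable borel"
    and ae: "AE x in lborel. f' x = f x"
  shows "integrable lborel f'" "integral\<^sup>L lborel f' = integral\<^sup>L lebesgue f"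
proof -
  have ae': "AE x in lebesgue. f' x = f x" using ae by (rule AE_completion)
  have m: "f' \<in> borel_measurable lebesgue" using f' by (simp add: measurable_completion)
  have "integrable lebesgue f'"
    using integrable_cong_AE_imp[OF f m] ae' by (simp add: eq_commute)
  then show "integrable lborel f'" using f' by (simp add: integrable_completion)
  have "integral\<^sup>L lborel f' = integral\<^sup>L lebesgue f'" using f' by (simp add: integral_completion)
  also have "\<dots> = integral\<^sup>L lebesgue f"
    using m f ae' by (intro integral_cong_AE) auto
  finally show "integral\<^sup>L lborel f' = integral\<^sup>L lebesgue f" .
qed

lemma integral_ge_psum_lebesgue:
  fixes f g h :: "'a::euclidean_space \<Rightarrow> real"
  assumes s: "0 \<le> s" and cd: "0 < c" "0 < d"
    and integrable: "integrable lebesgue f" "integrable lebesgue g" "integrable lebesgue h"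
    and nonneg: "\<And>x. 0 \<le> f x" "\<And>x. 0 \<le> g x" "\<And>x. 0 \<le> h x"
    and bdd: "bdd_above (range f)" "bdd_above (range g)" "bdd_above (range h)"
    and pos: "0 < integral\<^sup>L lebesgue f" "0 < integral\<^sup>L lebesgue g"
    and cond: "\<And>x y. 0 < f x \<Longrightarrow> 0 < g y \<Longrightarrow>
      psum s (c powr s * f x) (d powr s * g y) \<le> h (c *\<^sub>R x + d *\<^sub>R y)"
  shows "psum (s + real DIM('a)) (c powr (s + real DIM('a)) * integral\<^sup>L lebesgue f)
      (d powr (s + real DIM('a)) * integral\<^sup>L lebesgue g) \<le> integral\<^sup>L lebesgue h"
proof -
  obtain A B C where K: "\<And>x. f x \<le> A" "\<And>x. g x \<le> B" "\<And>x. h x \<le> C"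
    using bdd by (auto simp: bdd_above_def)
  obtain f' where f': "f' \<in> borel_measurable borel" "\<And>x. 0 \<le> f' x" "\<And>x. f' x \<le> f x"
      "AE x in lborel. f' x = f x"
    using borel_minorant[OF borel_measurable_integrable[OF integrable(1)] nonneg(1)] by blast
  obtain g' where g': "g' \<in> borel_measurable borel" "\<And>x. 0 \<le> g' x" "\<And>x. g' x \<le> g x"
      "AE x in lborel. g' x = g x"
    using borel_minorant[OF borel_measurable_integrable[OF integrable(2)] nonneg(2)] by blast
  obtain h' where h': "h' \<in> borel_measurable borel" "\<And>x. h x \<le> h' x" "\<And>x. h' x \<le> C"
      "AE x in lborel. h' x = h x"
    using borel_majorant[OF borel_measurable_integrable[OF integrable(3)] K(3)] by blast
  note F = lborel_integral_eq_lebesgue[OF integrable(1) f'(1,4)]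
  note G = lborel_integral_eq_lebesgue[OF integrable(2) g'(1,4)]
  note H = lborel_integral_eq_lebesgue[OF integrable(3) h'(1,4)]
  show ?thesis
    unfolding F(2)[symmetric] G(2)[symmetric] H(2)[symmetric]
  proof (rule integral_ge_psum_scaled[OF s cd F(1) G(1) H(1) f'(2) g'(2)])
    show "0 \<le> h' x" for x using nonneg(3) h'(2) by (rule order_trans)
    show "bdd_above (range f')" "bdd_above (range g')" "bdd_above (range h')"
      using order_trans[OF f'(3) K(1)] order_trans[OF g'(3) K(2)] h'(3)
      unfolding bdd_above_def by blast+
    show "0 < integral\<^sup>L lborel f'" "0 < integral\<^sup>L lborel g'"
      using pos by (simp_all add: F G)
    fix x y assume xy: "0 < f' x" "0 < g' y"
    have "psum s (c powr s * f' x) (d powr s * g' y) \<le> psum s (c powr s * f x) (d powr s * g y)"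
      using s f' g' by (intro psum_mono) (auto intro: mult_left_mono)
    also have "\<dots> \<le> h (c *\<^sub>R x + d *\<^sub>R y)"
      using xy f'(3)[of x] g'(3)[of y] by (intro cond) auto
    also have "\<dots> \<le> h' (c *\<^sub>R x + d *\<^sub>R y)" by (rule h')
    finally show "psum s (c powr s * f' x) (d powr s * g' y) \<le> h' (c *\<^sub>R x + d *\<^sub>R y)" .
  qed
qed

section \<open>The brackets and the choice of the parameter\<close>

text \<open>
  Positive coefficients can be moved inside the arguments, to the power \<open>s\<close>.  For
  \<open>s = 0\<close> they vanish in the limit: the bracket with exponent \<open>\<sigma>\<close> lies between
  \<open>e\<^bsup>\<sigma>\<^esup> max a b\<close> for \<open>e\<close> the smaller coefficient and for \<open>e\<close> the sum of the two.
\<close>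
lemma bracket_eq_psum:
  assumes s: "0 \<le> s" and ab: "0 < a" "0 < b" and cd: "0 < coeff_f p t l" "0 < coeff_g p t l"
  shows "bracket p s t l a b = psum s (coeff_f p t l powr s * a) (coeff_g p t l powr s * b)"
proof (cases "s = 0")
  case False
  then show ?thesis using s cd
    by (simp add: bracket_def bracket_pos_def psum_def powr_mult powr_powr)
next
  case True
  define c d m where "c = coeff_f p t l" and "d = coeff_g p t l" and "m = max a b"
  have pos: "0 < c" "0 < d" "0 < m" using cd ab by (simp_all add: c_def d_def m_def)
  have bound: "min c d powr \<sigma> * m \<le> bracket_pos p \<sigma> t l a b \<and> bracket_pos p \<sigma> t l a b \<le> (c + d) powr \<sigma> * m"
    if \<sigma>: "0 < \<sigma>" for \<sigma>
  proof -
    define A B M where "A = a powr (1 / \<sigma>)" and "B = b powr (1 / \<sigma>)" and "M = m powr (1 / \<sigma>)"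
    have M: "A \<le> M" "B \<le> M" "M = A \<or> M = B" "0 < A" "0 < B" "0 < M" "m = M powr \<sigma>"
      using \<sigma> ab pos by (auto simp: A_def B_def M_def m_def max_def powr_powr intro!: powr_mono2)
    have "c * A \<le> c * M" "d * B \<le> d * M"
      using M pos by (auto intro: mult_left_mono)
    then have up: "c * A + d * B \<le> (c + d) * M" by (simp add: distrib_right)
    have "min c d * A \<le> c * A" "min c d * B \<le> d * B" "0 \<le> c * A" "0 \<le> d * B"
      using M pos by (auto intro: mult_right_mono)
    then have lo: "min c d * M \<le> c * A + d * B" using M(3) by auto
    have eq: "bracket_pos p \<sigma> t l a b = (c * A + d * B) powr \<sigma>"
      by (simp add: bracket_pos_def A_def B_def c_def d_def)
    show ?thesis
      unfolding eq M(7) powr_mult[symmetric] using up lo \<sigma> pos M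
      by (auto intro!: powr_mono2)
  qed
  have "((\<lambda>\<sigma>. e powr \<sigma> * m) \<longlongrightarrow> e powr 0 * m) (at_right 0)" if "0 < e" for e
    using that by (intro tendsto_intros) auto
  then have lim: "((\<lambda>\<sigma>. e powr \<sigma> * m) \<longlongrightarrow> m) (at_right 0)" if "0 < e" for e
    using that by simp
  have "((\<lambda>\<sigma>. bracket_pos p \<sigma> t l a b) \<longlongrightarrow> m) (at_right 0)"
  proof (rule tendsto_sandwich[OF _ _ lim[of "min c d"] lim[of "c + d"]])
    show "\<forall>\<^sub>F \<sigma> in at_right 0. min c d powr \<sigma> * m \<le> bracket_pos p \<sigma> t l a b"
      "\<forall>\<^sub>F \<sigma> in at_right 0. bracket_pos p \<sigma> t l a b \<le> (c + d) powr \<sigma> * m"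
      using bound by (auto simp: eventually_at_right_less intro: eventually_mono[OF eventually_at_right_less])
  qed (use pos in auto)
  then have "Lim (at_right 0) (\<lambda>\<sigma>. bracket_pos p \<sigma> t l a b) = m"
    by (intro tendsto_Lim) auto
  then show ?thesis using True cd by (simp add: bracket_def psum_def m_def)
qed

text \<open>
  This serves the end points \<open>t = 0\<close> and \<open>t = 1\<close>, where one of the coefficients is zero
  for every parameter and the dilation argument breaks down.
\<close>
lemma bracket_degenerate:
  assumes s: "0 \<le> s" and ab: "0 < a" "0 < b"
  shows "coeff_f p t l = 1 \<Longrightarrow> coeff_g p t l = 0 \<Longrightarrow> bracket p s t l a b = a"
    and "coeff_f p t l = 0 \<Longrightarrow> coeff_g p t l = 1 \<Longrightarrow> bracket p s t l a b = b"
proof -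
  have bracketI: "bracket p s t l a b = r" if "\<And>\<sigma>. 0 < \<sigma> \<Longrightarrow> bracket_pos p \<sigma> t l a b = r" for r
  proof -
    have "((\<lambda>\<sigma>. bracket_pos p \<sigma> t l a b) \<longlongrightarrow> r) (at_right 0)"
      by (intro tendsto_eventually eventually_mono[OF eventually_at_right_less]) (rule that)
    then have "Lim (at_right 0) (\<lambda>\<sigma>. bracket_pos p \<sigma> t l a b) = r"
      by (intro tendsto_Lim) auto
    then show ?thesis using that[of s] s by (auto simp: bracket_def)
  qed
  show "bracket p s t l a b = a" if "coeff_f p t l = 1" "coeff_g p t l = 0"
    by (rule bracketI) (use that ab in \<open>simp add: bracket_pos_def powr_powr\<close>)
  show "bracket p s t l a b = b" if "coeff_f p t l = 0" "coeff_g p t l = 1"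
    by (rule bracketI) (use that ab in \<open>simp add: bracket_pos_def powr_powr\<close>)
qed

text \<open>
  The equality case of Hoelder's inequality with exponents \<open>p\<close> and \<open>p / (p - 1)\<close>: the
  right-hand side is the largest value that the left-hand side takes as \<open>l\<close> varies, and
  \<open>l\<close> is the share of \<open>t b\<^sup>p\<close> in \<open>(1 - t) a\<^sup>p + t b\<^sup>p\<close>.
\<close>
lemma exists_optimal_coeffs:
  assumes p: "1 \<le> p" and t: "0 < t" "t < 1" and ab: "0 < a" "0 < b"
  obtains l where "0 \<le> l" "l \<le> 1" "0 < coeff_f p t l" "0 < coeff_g p t l"
    "coeff_f p t l * a + coeff_g p t l * b = ((1 - t) * a powr p + t * b powr p) powr (1 / p)"
proof -
  define u v S where "u = (1 - t) * a powr p" and "v = t * b powr p" and "S = u + v"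
  have pos: "0 < u" "0 < v" "0 < S" using t ab by (simp_all add: u_def v_def S_def add_pos_pos)
  define l where "l = v / S"
  have l: "0 < l" "l < 1" and l1: "1 - l = u / S"
    using pos by (auto simp: l_def S_def field_simps)
  define r where "r = (p - 1) / p"
  have r: "r = 1 - 1 / p" using p by (simp add: r_def diff_divide_distrib)
  have powr1: "powr1 x r = x powr r" if "0 < x" for x
    using that by (simp add: powr1_def)
  have part: "w powr (1 / p) * (y / S) powr r * z = y / S powr r"
    if "y = w * z powr p" "0 < w" "0 < z" for w y z
  proof -
    have "w powr (1 / p) * z = y powr (1 / p)"
      using that p by (simp add: powr_mult powr_powr)
    moreover have "y powr (1 / p) * y powr r = y"
      using that by (simp add: r flip: powr_add)
    moreover have "w powr (1 / p) * (y / S) powr r * z = (w powr (1 / p) * z) * y powr r / S powr r"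
      by (simp add: powr_divide)
    ultimately show ?thesis by (simp only:)
  qed
  have f: "coeff_f p t l = (1 - t) powr (1 / p) * (u / S) powr r"
    and g: "coeff_g p t l = t powr (1 / p) * (v / S) powr r"
    using l powr1 by (simp_all add: coeff_f_def coeff_g_def l1[symmetric] flip: r_def l_def)
  have "coeff_f p t l * a + coeff_g p t l * b = u / S powr r + v / S powr r"
    unfolding f g using part[of u "1 - t" a] part[of v t b] t ab by (simp add: u_def v_def)
  also have "\<dots> = S / S powr r" by (simp add: S_def add_divide_distrib)
  also have "\<dots> = S powr (1 / p)"
    using pos powr_diff[of S 1 r] by (simp add: r)
  finally have "coeff_f p t l * a + coeff_g p t l * b = S powr (1 / p)" .
  moreover have "0 < coeff_f p t l" "0 < coeff_g p t l"
    unfolding f g using pos t by simp_all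
  ultimately show ?thesis using that[of l] l by (simp add: S_def u_def v_def)
qed

section \<open>The Lp Borell-Brascamp-Lieb inequality\<close>

theorem theorem2p1:
  fixes p s t :: real
    and f g h :: "real ^ 'n \<Rightarrow> real"
  assumes p: "1 \<le> p"
    and s: "0 \<le> s"
    and t: "0 \<le> t" "t \<le> 1"
    and nonneg: "\<And>x. 0 \<le> f x" "\<And>x. 0 \<le> g x" "\<And>x. 0 \<le> h x"
    and bounded: "bounded (range f)" "bounded (range g)" "bounded (range h)"
    and integrable: "integrable lebesgue f" "integrable lebesgue g" "integrable lebesgue h"
    and cond: "\<And>x y l. \<lbrakk>x \<in> supp f; y \<in> supp g; 0 \<le> l; l \<le> 1\<rbrakk> \<Longrightarrow>
      h (coeff_f p t l *\<^sub>R x + coeff_g p t l *\<^sub>R y) \<ge> bracket p s t l (f x) (g y)"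
  shows "(\<integral>x. h x \<partial>lebesgue) \<ge>
    power_mean (p / (real CARD('n) + s)) t (\<integral>x. f x \<partial>lebesgue) (\<integral>x. g x \<partial>lebesgue)"
proof -
  define X Y where "X = integral\<^sup>L lebesgue f" and "Y = integral\<^sup>L lebesgue g"
  define q where "q = s + real CARD('n)"
  have q: "0 < q" using s by (simp add: q_def add_nonneg_pos)
  have nn: "0 \<le> X" "0 \<le> Y" "0 \<le> integral\<^sup>L lebesgue h"
    using nonneg by (simp_all add: X_def Y_def integral_nonneg_AE)
  consider "X * Y = 0" | "0 < X" "0 < Y" "t = 0" | "0 < X" "0 < Y" "t = 1"
    | "0 < X" "0 < Y" "0 < t" "t < 1"
    using nn t by fastforce
  then have "power_mean (p / q) t X Y \<le> integral\<^sup>L lebesgue h"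
  proof cases
    case 1
    then show ?thesis using nn by (simp only: power_mean_def) simp
  next
    case 2
    \<comment> \<open>The parameter \<open>0\<close> turns the hypothesis into \<open>f \<le> h\<close>, once \<open>g\<close> has a nonempty support.\<close>
    obtain y where y: "0 < g y" using exists_pos_if_integral_pos[of lebesgue g] 2(2) by (auto simp: Y_def)
    have "coeff_f p t 0 = 1" "coeff_g p t 0 = 0"
      using 2 p by (simp_all add: coeff_f_def coeff_g_def powr1_def)
    then have "f x \<le> h x" if "0 < f x" for x
      using cond[of x y 0] that y s by (simp add: supp_def bracket_degenerate)
    then have "f x \<le> h x" for x
      using nonneg(1)[of x] nonneg(3)[of x] by (cases "f x = 0") auto
    then have "X \<le> integral\<^sup>L lebesgue h"
      unfolding X_def by (intro integral_mono integrable)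
    then show ?thesis using 2 p q by (simp add: power_mean_def powr_powr)
  next
    case 3
    obtain x where x: "0 < f x" using exists_pos_if_integral_pos[of lebesgue f] 3(1) by (auto simp: X_def)
    have "coeff_f p t 1 = 0" "coeff_g p t 1 = 1"
      using 3 p by (simp_all add: coeff_f_def coeff_g_def powr1_def)
    then have "g y \<le> h y" if "0 < g y" for y
      using cond[of x y 1] that x s by (simp add: supp_def bracket_degenerate)
    then have "g y \<le> h y" for y
      using nonneg(2)[of y] nonneg(3)[of y] by (cases "g y = 0") auto
    then have "Y \<le> integral\<^sup>L lebesgue h"
      unfolding Y_def by (intro integral_mono integrable)
    then show ?thesis using 3 p q by (simp add: power_mean_def powr_powr)
  next
    case 4
    \<comment> \<open>The conclusion for fixed \<open>l\<close> is \<open>(c a + d b)\<^sup>q \<le> \<integral>h\<close> with \<open>c\<close>, \<open>d\<close> the coefficients,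
        so \<open>l\<close> is chosen for these \<open>a\<close> and \<open>b\<close>.\<close>
    define a b where "a = X powr (1 / q)" and "b = Y powr (1 / q)"
    have ab: "0 < a" "0 < b" using 4 by (simp_all add: a_def b_def)
    obtain l where l: "0 \<le> l" "l \<le> 1" and cd: "0 < coeff_f p t l" "0 < coeff_g p t l"
      and opt: "coeff_f p t l * a + coeff_g p t l * b = ((1 - t) * a powr p + t * b powr p) powr (1 / p)"
      using exists_optimal_coeffs[OF p 4(3,4) ab] by blast
    have "power_mean (p / q) t X Y = ((1 - t) * a powr p + t * b powr p) powr (q / p)"
      using 4 by (simp add: power_mean_def a_def b_def powr_powr)
    also have "\<dots> = (coeff_f p t l * a + coeff_g p t l * b) powr q"
      by (simp add: opt powr_powr)
    also have "\<dots> = psum q (coeff_f p t l powr q * X) (coeff_g p t l powr q * Y)"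
      using q cd by (simp add: psum_def a_def b_def powr_mult powr_powr)
    also have "\<dots> \<le> integral\<^sup>L lebesgue h"
    proof -
      have bdd: "bdd_above (range f)" "bdd_above (range g)" "bdd_above (range h)"
        using bounded by (auto intro: bounded_imp_bdd_above)
      have "psum s (coeff_f p t l powr s * f x) (coeff_g p t l powr s * g y)
          \<le> h (coeff_f p t l *\<^sub>R x + coeff_g p t l *\<^sub>R y)" if "0 < f x" "0 < g y" for x y
        using cond[of x y l] that l bracket_eq_psum[OF s that cd] by (simp add: supp_def)
      then show ?thesis
        using integral_ge_psum_lebesgue[OF s cd integrable nonneg bdd] 4
        by (simp add: q_def X_def Y_def)
    qed
    finally show ?thesis .
  qed
  then show ?thesis by (simp add: X_def Y_def q_def add.commute)
qed

end
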